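(* For every positive integer $n\le17$, every qualitative probability order $\preceq$ on $[n]$ and every $T\subseteq[n]$, the initial segment $\Delta=\Delta(\preceq,T)$ satisfies $CC_4^*$; that is, there is no trading transform $(A_1,A_2,A_3,A_4;B_1,B_2,B_3,B_4)$ of subsets of $[n]$ with $A_i\in\Delta$ and $B_i\notin\Delta$ for all $i\in\{1,2,3,4\}$.
   Context: $[n]=\{1,\dots,n\}$. An order is a reflexive, complete and transitive binary relation. A qualitative probability order on $[n]$ is an order $\preceq$ on $2^{[n]}$ such that (1) $\emptyset\preceq A$ for every nonempty $A\subseteq[n]$, and (2) for all $A,B,C\subseteq[n]$ with $(A\cup B)\cap C=\emptyset$: $A\preceq B\iff A\cup C\preceq B\cup C$. $X\prec Y$ means $X\preceq Y$ but not $Y\preceq X$, and $\Delta(\preceq,T)=\{X\subseteq[n]\mid X\prec T\}$. A sequence $(A_1,\dots,A_k;B_1,\dots,B_k)$ of subsets of $[n]$ (repetitions allowed) is a trading transform of length $k$ if for every $i\in[n]$, $|\{j\mid i\in A_j\}|=|\{j\mid i\in B_j\}|$. *)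

theory Defs
  imports Main
begin

text \<open>
  The ground set \<open>[n]\<close> is \<^term>\<open>{1..n}\<close> and a binary relation on its power set is a predicate on
  \<^typ>\<open>nat set\<close>; only its values on \<^term>\<open>Pow {1..n}\<close> matter.
\<close>

text \<open>
  Completeness relates any two elements, equal or not. The library's \<^const>\<open>totalp_on\<close> covers the
  distinct ones, so it gives completeness together with reflexivity.
\<close>

definition order_on :: "'a set \<Rightarrow> ('a \<Rightarrow> 'a \<Rightarrow> bool) \<Rightarrow> bool" where
  "order_on S R \<longleftrightarrow> reflp_on S R \<and> totalp_on S R \<and> transp_on S R"

definition qualitative_probability_order :: "nat \<Rightarrow> (nat set \<Rightarrow> nat set \<Rightarrow> bool) \<Rightarrow> bool" where
  "qualitative_probability_order n R \<longleftrightarrow>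
     order_on (Pow {1..n}) R \<and>
     (\<forall>A. A \<subseteq> {1..n} \<and> A \<noteq> {} \<longrightarrow> R {} A) \<and>
     (\<forall>A B C. A \<subseteq> {1..n} \<and> B \<subseteq> {1..n} \<and> C \<subseteq> {1..n} \<and> (A \<union> B) \<inter> C = {} \<longrightarrow>
        (R A B \<longleftrightarrow> R (A \<union> C) (B \<union> C)))"

definition strict_part :: "('a \<Rightarrow> 'a \<Rightarrow> bool) \<Rightarrow> 'a \<Rightarrow> 'a \<Rightarrow> bool" where
  "strict_part R x y \<longleftrightarrow> R x y \<and> \<not> R y x"

definition initial_segment :: "nat \<Rightarrow> (nat set \<Rightarrow> nat set \<Rightarrow> bool) \<Rightarrow> nat set \<Rightarrow> nat set set" where
  "initial_segment n R T = {X. X \<subseteq> {1..n} \<and> strict_part R X T}"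

text \<open>
  A sequence of length \<open>k\<close> is a function of which only the values at \<open>1, \<dots>, k\<close> matter.
\<close>

definition trading_transform ::
    "nat \<Rightarrow> nat \<Rightarrow> (nat \<Rightarrow> nat set) \<Rightarrow> (nat \<Rightarrow> nat set) \<Rightarrow> bool" where
  "trading_transform n k A B \<longleftrightarrow>
     (\<forall>j\<in>{1..k}. A j \<subseteq> {1..n} \<and> B j \<subseteq> {1..n}) \<and>
     (\<forall>i\<in>{1..n}. card {j\<in>{1..k}. i \<in> A j} = card {j\<in>{1..k}. i \<in> B j})"

definition CC_star :: "nat \<Rightarrow> nat \<Rightarrow> nat set set \<Rightarrow> bool" where
  "CC_star n k D \<longleftrightarrow>
     \<not> (\<exists>A B. trading_transform n k A B \<and> (\<forall>j\<in>{1..k}. A j \<in> D \<and> B j \<notin> D))"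

end

theory Submission
  imports Defs
begin

text \<open>
  Suppose \<open>(A\<^sub>1,\<dots>,A\<^sub>4;B\<^sub>1,\<dots>,B\<^sub>4)\<close> violates \<open>CC\<^sub>4\<^sup>*\<close>, so that \<open>A\<^sub>i \<prec> B\<^sub>j\<close> for all \<open>i, j\<close>. For two-element
  sets \<open>I, J\<close> of indices consider the vector \<open>v = \<Sum>\<^sub>j\<^sub>\<in>\<^sub>J \<chi>(B\<^sub>j) - \<Sum>\<^sub>i\<^sub>\<in>\<^sub>I \<chi>(A\<^sub>i)\<close>. If its entries are in
  \<open>{-1,0,1}\<close>, say \<open>v = \<chi>(Y) - \<chi>(X)\<close>, then adding comparisons gives \<open>X \<prec> Y\<close>, while the complementary
  index sets yield \<open>-v\<close> and hence \<open>Y \<prec> X\<close>. So \<open>v\<close> has an entry \<open>\<plusminus>2\<close> at some \<open>x\<close>, which by balance forces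
  the index pattern of \<open>x\<close> to be \<open>(I, -J)\<close> or \<open>(-I, J)\<close>. Such a pattern determines \<open>{(I, J), (-I, -J)}\<close>,
  and there are \<open>6 \<cdot> 6 / 2 = 18\<close> of these classes; so there are at least \<open>18\<close> elements.
\<close>

lemma strict_part_Un_iff:
  assumes "qualitative_probability_order n R"
    and "A \<subseteq> {1..n}" "B \<subseteq> {1..n}" "C \<subseteq> {1..n}" "(A \<union> B) \<inter> C = {}"
  shows "strict_part R (A \<union> C) (B \<union> C) \<longleftrightarrow> strict_part R A B"
proof -
  have "R A B \<longleftrightarrow> R (A \<union> C) (B \<union> C)" "R B A \<longleftrightarrow> R (B \<union> C) (A \<union> C)"
    using assms unfolding qualitative_probability_order_def by (simp_all add: Un_commute)
  then show ?thesis by (simp add: strict_part_def)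
qed

lemma strict_part_Diff_iff:
  assumes "qualitative_probability_order n R" "A \<subseteq> {1..n}" "B \<subseteq> {1..n}"
  shows "strict_part R (A - B) (B - A) \<longleftrightarrow> strict_part R A B"
proof -
  have "strict_part R (A - B \<union> A \<inter> B) (B - A \<union> A \<inter> B) \<longleftrightarrow> strict_part R (A - B) (B - A)"
    using assms by (intro strict_part_Un_iff) auto
  moreover have "A - B \<union> A \<inter> B = A" "B - A \<union> A \<inter> B = B" by auto
  ultimately show ?thesis by simp
qed

lemma strict_part_trans:
  assumes "qualitative_probability_order n R" "A \<subseteq> {1..n}" "B \<subseteq> {1..n}" "C \<subseteq> {1..n}"
    and "strict_part R A B" "R B C"
  shows "strict_part R A C"
proof -
  have "transp_on (Pow {1..n}) R"
    using assms(1) by (simp add: qualitative_probability_order_def order_on_def)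
  then show ?thesis
    using assms(2-) unfolding strict_part_def transp_on_def by (meson PowI)
qed

text \<open>With chi for characteristic functions, \<open>bal\<close> says chi(Y) - chi(X) = (chi(B)
  - chi(A)) + (chi(D) - chi(C)). After cancelling common elements in each pair, the two comparisons
  are padded so that they meet in the same middle set.\<close>

lemma strict_part_add:
  assumes Q: "qualitative_probability_order n R"
    and sub: "A \<subseteq> {1..n}" "B \<subseteq> {1..n}" "C \<subseteq> {1..n}" "D \<subseteq> {1..n}" "X \<subseteq> {1..n}" "Y \<subseteq> {1..n}"
    and AB: "strict_part R A B" and CD: "strict_part R C D"
    and bal: "\<And>x. of_bool (x \<in> X) + of_bool (x \<in> B) + of_bool (x \<in> D) =
                  of_bool (x \<in> Y) + of_bool (x \<in> A) + (of_bool (x \<in> C) :: nat)"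
  shows "strict_part R X Y"
proof -
  define A' B' C' D' where defs: "A' = A - B" "B' = B - A" "C' = C - D" "D' = D - C"
  \<comment> \<open>A point of \<open>A' \<inter> C'\<close> or \<open>B' \<inter> D'\<close> would
    make the right-hand sum -2 or 2, but chi(Y) - chi(X) has entries in {-1,0,1}. This disjointness
    is what permits the padding below.\<close>
  have pointwise: "(x \<in> X - Y \<longleftrightarrow> x \<in> (A' - D') \<union> (C' - B')) \<and> (x \<in> Y - X \<longleftrightarrow> x \<in> (D' - A') \<union> (B' - C')) \<and>
      x \<notin> A' \<inter> C' \<and> x \<notin> B' \<inter> D'" for x
    using bal[of x] unfolding defs
    by (cases "x \<in> X"; cases "x \<in> Y"; cases "x \<in> A"; cases "x \<in> B"; cases "x \<in> C"; cases "x \<in> D") simp_all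
  have XY: "X - Y = (A' - D') \<union> (C' - B')" "Y - X = (D' - A') \<union> (B' - C')"
    using pointwise by (intro set_eqI, simp only:)+
  have disj: "A' \<inter> C' = {}" "B' \<inter> D' = {}"
    by (simp_all only: set_eq_iff pointwise empty_iff simp_thms)
  have disj': "A' \<inter> B' = {}" "C' \<inter> D' = {}" unfolding defs by blast+
  have sub': "A' \<subseteq> {1..n}" "B' \<subseteq> {1..n}" "C' \<subseteq> {1..n}" "D' \<subseteq> {1..n}"
    using sub unfolding defs by blast+
  have "strict_part R A' B'" "strict_part R C' D'"
    using AB CD strict_part_Diff_iff[OF Q] sub unfolding defs by simp_all
  \<comment> \<open>The padding makes both middle sets equal to
    \<open>B' \<union> C'\<close>.\<close>
  moreover have "strict_part R (A' \<union> (C' - B')) (B' \<union> (C' - B')) \<longleftrightarrow> strict_part R A' B'"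
    using sub' disj by (intro strict_part_Un_iff[OF Q]) blast+
  moreover have "strict_part R (C' \<union> (B' - C')) (D' \<union> (B' - C')) \<longleftrightarrow> strict_part R C' D'"
    using sub' disj by (intro strict_part_Un_iff[OF Q]) blast+
  moreover have "C' \<union> (B' - C') = B' \<union> (C' - B')" by blast
  ultimately have "strict_part R (A' \<union> (C' - B')) (B' \<union> (C' - B'))"
    and "R (B' \<union> (C' - B')) (D' \<union> (B' - C'))"
    by (simp_all add: strict_part_def)
  then have "strict_part R (A' \<union> (C' - B')) (D' \<union> (B' - C'))"
    using sub' by (rule_tac strict_part_trans[OF Q, where B = "B' \<union> (C' - B')"]) blast+
  \<comment> \<open>The two ends share exactly \<open>A' \<inter> D'\<close>; cancelling it leaves
    \<open>X - Y\<close> and \<open>Y - X\<close>.\<close>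
  moreover have "(A' \<union> (C' - B')) - (D' \<union> (B' - C')) = X - Y"
    "(D' \<union> (B' - C')) - (A' \<union> (C' - B')) = Y - X"
    unfolding XY using disj disj' by blast+
  moreover have "A' \<union> (C' - B') \<subseteq> {1..n}" "D' \<union> (B' - C') \<subseteq> {1..n}"
    using sub' by blast+
  ultimately show ?thesis
    using strict_part_Diff_iff[OF Q sub(5,6)]
      strict_part_Diff_iff[OF Q, of "A' \<union> (C' - B')" "D' \<union> (B' - C')"] by simp
qed

text \<open>The set \<open>T\<close> separates the two: \<open>strict_part R A T\<close> by
  membership and \<open>R T B\<close> by completeness, with reflexivity covering
  \<open>B = T\<close>.\<close>

lemma strict_part_initial_segment:
  assumes Q: "qualitative_probability_order n R" and "T \<subseteq> {1..n}"
    and "A \<in> initial_segment n R T" "B \<subseteq> {1..n}" "B \<notin> initial_segment n R T"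
  shows "strict_part R A B"
proof -
  have "reflp_on (Pow {1..n}) R" "totalp_on (Pow {1..n}) R"
    using Q by (simp_all add: qualitative_probability_order_def order_on_def)
  then have "R T B \<or> strict_part R B T"
    using assms unfolding reflp_on_def totalp_on_def strict_part_def by (metis PowI)
  then show ?thesis
    using assms strict_part_trans[OF Q, of A T B] by (auto simp: initial_segment_def)
qed

lemma card_Collect_eq_sum_of_bool:
  assumes "finite S"
  shows "card {j \<in> S. P j} = (\<Sum>j\<in>S. of_bool (P j))"
  using assms by (simp add: Collect_conj_eq)

text \<open>The first alternative is an entry -2 of the vector v for \<open>(I, J)\<close>, the
  second an entry 2. Without either, v and -v would both be differences of characteristic functions,
  giving two opposite strict comparisons.\<close>

lemma extreme_element_of_index_pairs:
  assumes Q: "qualitative_probability_order n R"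
    and tt: "trading_transform n 4 A B"
    and less: "\<And>i j. i \<in> {1..4} \<Longrightarrow> j \<in> {1..4} \<Longrightarrow> strict_part R (A i) (B j)"
    and I: "I \<subseteq> {1..4}" "card I = 2" and J: "J \<subseteq> {1..4}" "card J = 2"
  obtains x where "x \<in> {1..n}"
    "{j \<in> {1..4}. x \<in> A j} = I \<and> {j \<in> {1..4}. x \<in> B j} = {1..4} - J \<or>
     {j \<in> {1..4}. x \<in> A j} = {1..4} - I \<and> {j \<in> {1..4}. x \<in> B j} = J"
proof (rule ccontr)
  assume "\<not> thesis"
  with that have none: "\<And>x. x \<in> {1..n} \<Longrightarrow>
     \<not> ({j \<in> {1..4}. x \<in> A j} = I \<and> {j \<in> {1..4}. x \<in> B j} = {1..4} - J \<or>
     {j \<in> {1..4}. x \<in> A j} = {1..4} - I \<and> {j \<in> {1..4}. x \<in> B j} = J)" by blast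
  have "card ({1..4} - I) = 2" "card ({1..4} - J) = 2"
    using I J by (simp_all add: card_Diff_subset finite_subset)
  with I J obtain i k i' k' j l j' l' where
    eqs: "I = {i, k}" "{1..4} - I = {i', k'}" "J = {j, l}" "{1..4} - J = {j', l'}"
    and neq: "i \<noteq> k" "i' \<noteq> k'" "j \<noteq> l" "j' \<noteq> l'"
    by (auto simp: card_2_iff)
  have inI: "{1..4} = {i, k} \<union> {i', k'}" "{i, k} \<inter> {i', k'} = {}"
    and inJ: "{1..4} = {j, l} \<union> {j', l'}" "{j, l} \<inter> {j', l'} = {}"
    using I J eqs by blast+
  have sub: "A m \<subseteq> {1..n}" "B m \<subseteq> {1..n}" if "m \<in> {1..4}" for m
    using tt that by (auto simp: trading_transform_def)
  define a where "a m x = (of_bool (x \<in> A m) :: nat)" for m x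
  define b where "b m x = (of_bool (x \<in> B m) :: nat)" for m x
  have a01: "a m x \<le> 1" and b01: "b m x \<le> 1" for m x
    by (simp_all add: a_def b_def)
  have sum_a: "(\<Sum>m\<in>{1..4}. a m x) = a i x + a k x + a i' x + a k' x" for x
    unfolding inI(1) using inI(2) neq by simp
  have sum_b: "(\<Sum>m\<in>{1..4}. b m x) = b j x + b l x + b j' x + b l' x" for x
    unfolding inJ(1) using inJ(2) neq by simp
  have mem: "i \<in> {1..4}" "k \<in> {1..4}" "i' \<in> {1..4}" "k' \<in> {1..4}"
    "j \<in> {1..4}" "l \<in> {1..4}" "j' \<in> {1..4}" "l' \<in> {1..4}"
    using I J eqs by blast+
  \<comment> \<open>Balance is given only on \<open>{1..n}\<close>, while
    \<open>strict_part_add\<close> asks for its identity at every number.\<close>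
  have outside: "a m x = 0" "b m x = 0" if "x \<notin> {1..n}" "m \<in> {1..4}" for m x
    using sub[OF that(2)] that(1) by (auto simp: a_def b_def)
  have bal: "a i x + a k x + a i' x + a k' x = b j x + b l x + b j' x + b l' x" for x
  proof (cases "x \<in> {1..n}")
    case True
    then have "card {m \<in> {1..4}. x \<in> A m} = card {m \<in> {1..4}. x \<in> B m}"
      using tt by (auto simp: trading_transform_def)
    then have "(\<Sum>m\<in>{1..4}. a m x) = (\<Sum>m\<in>{1..4}. b m x)"
      by (simp only: card_Collect_eq_sum_of_bool finite_atLeastAtMost a_def b_def)
    then show ?thesis by (simp only: sum_a sum_b)
  next
    case False
    then show ?thesis by (simp only: outside[OF False] mem)
  qed
  have set_a: "{m \<in> {1..4}. x \<in> A m} = {m \<in> {i, k, i', k'}. a m x = 1}" for x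
    unfolding inI(1) a_def by auto
  have set_b: "{m \<in> {1..4}. x \<in> B m} = {m \<in> {j, l, j', l'}. b m x = 1}" for x
    unfolding inJ(1) b_def by auto
  have mid: "a i x + a k x \<le> b j x + b l x + 1" "b j x + b l x \<le> a i x + a k x + 1"
    if x: "x \<in> {1..n}" for x
  proof -
    show "a i x + a k x \<le> b j x + b l x + 1"
    proof (rule ccontr)
      assume "\<not> ?thesis"
      \<comment> \<open>A gap of 2 between sums of two 0-1 values fixes all four of them; balance
        then fixes the other four.\<close>
      then have "a i x = 1" "a k x = 1" "a i' x = 0" "a k' x = 0"
        "b j x = 0" "b l x = 0" "b j' x = 1" "b l' x = 1"
        using bal[of x] a01[of i x] a01[of k x] b01[of j' x] b01[of l' x] by linarith+
      then have "{m \<in> {1..4}. x \<in> A m} = I" "{m \<in> {1..4}. x \<in> B m} = {1..4} - J"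
        unfolding eqs(2,4) unfolding set_a set_b eqs(1,3) by auto
      with none[OF x] show False by blast
    qed
    show "b j x + b l x \<le> a i x + a k x + 1"
    proof (rule ccontr)
      assume "\<not> ?thesis"
      then have "a i x = 0" "a k x = 0" "a i' x = 1" "a k' x = 1"
        "b j x = 1" "b l x = 1" "b j' x = 0" "b l' x = 0"
        using bal[of x] b01[of j x] b01[of l x] a01[of i' x] a01[of k' x] by linarith+
      then have "{m \<in> {1..4}. x \<in> A m} = {1..4} - I" "{m \<in> {1..4}. x \<in> B m} = J"
        unfolding eqs(2,4) unfolding set_a set_b eqs(1,3) by auto
      with none[OF x] show False by blast
    qed
  qed
  \<comment> \<open>\<open>X\<close> and \<open>Y\<close> are the negative and positive supports of
    v; by \<open>mid\<close> its entries lie in {-1,0,1}, so v = chi(Y) - chi(X).\<close>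
  define X where "X = {x \<in> {1..n}. a i x + a k x > b j x + b l x}"
  define Y where "Y = {x \<in> {1..n}. a i x + a k x < b j x + b l x}"
  have XY: "of_bool (x \<in> X) + b j x + b l x = of_bool (x \<in> Y) + a i x + a k x" for x
  proof (cases "x \<in> {1..n}")
    case True
    then show ?thesis using mid[OF True] by (auto simp: X_def Y_def of_bool_def)
  next
    case False
    then have "x \<notin> X" "x \<notin> Y" by (auto simp: X_def Y_def)
    then show ?thesis by (simp only: outside[OF False] mem)
  qed
  have YX: "of_bool (x \<in> Y) + b j' x + b l' x = of_bool (x \<in> X) + a i' x + a k' x" for x
    using XY[of x] bal[of x] by linarith
  have "X \<subseteq> {1..n}" "Y \<subseteq> {1..n}" by (auto simp: X_def Y_def)
  then have "strict_part R X Y" "strict_part R Y X"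
    using XY YX mem sub less
    by (intro strict_part_add[OF Q, of "A i" "B j" "A k" "B l" X Y]
        strict_part_add[OF Q, of "A i'" "B j'" "A k'" "B l'" Y X]; simp add: a_def b_def)+
  then show False by (simp add: strict_part_def)
qed

theorem theorem5:
  fixes n :: nat and R :: "nat set \<Rightarrow> nat set \<Rightarrow> bool" and T :: "nat set"
  assumes "1 \<le> n" and "n \<le> 17"
    and "qualitative_probability_order n R"
    and "T \<subseteq> {1..n}"
  shows "CC_star n 4 (initial_segment n R T)"
  unfolding CC_star_def
proof (rule notI, elim exE conjE)
  fix A B
  assume tt: "trading_transform n 4 A B"
    and seg: "\<forall>j\<in>{1..4}. A j \<in> initial_segment n R T \<and> B j \<notin> initial_segment n R T"
  have less: "strict_part R (A i) (B j)" if "i \<in> {1..4}" "j \<in> {1..4}" for i j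
    using that seg tt by (intro strict_part_initial_segment[OF assms(3,4)]) (auto simp: trading_transform_def)
  define \<J> where "\<J> = {J. J \<subseteq> {1..4::nat} \<and> card J = 2}"
  \<comment> \<open>Each class {(I, J), (-I, -J)} is represented by its member with 1 in I, so I =
    \<open>{1, k}\<close>. This leaves 3 * 6 = 18 pairs.\<close>
  define K where "K = {2..4::nat} \<times> \<J>"
  define pat where "pat x = ({j \<in> {1..4}. x \<in> A j}, {j \<in> {1..4}. x \<in> B j})" for x
  have "\<exists>x. x \<in> {1..n} \<and> pat x \<in> {({1, k}, {1..4} - J), ({1..4} - {1, k}, J)}"
    if kJ: "(k, J) \<in> K" for k J
  proof -
    have "{1, k} \<subseteq> {1..4}" "card {1, k} = 2" "J \<subseteq> {1..4}" "card J = 2"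
      using kJ by (auto simp: K_def \<J>_def)
    from extreme_element_of_index_pairs[OF assms(3) tt less this] obtain x where "x \<in> {1..n}"
      "{j \<in> {1..4}. x \<in> A j} = {1, k} \<and> {j \<in> {1..4}. x \<in> B j} = {1..4} - J \<or>
       {j \<in> {1..4}. x \<in> A j} = {1..4} - {1, k} \<and> {j \<in> {1..4}. x \<in> B j} = J" .
    then show ?thesis
      unfolding pat_def by (intro exI[of _ x]) (simp only: insert_iff prod.inject empty_iff simp_thms)
  qed
  then have "\<forall>p\<in>K. \<exists>x. x \<in> {1..n} \<and>
      pat x \<in> {({1, fst p}, {1..4} - snd p), ({1..4} - {1, fst p}, snd p)}"
    by (simp add: case_prod_beta' split_paired_all)
  then obtain f where f: "\<And>p. p \<in> K \<Longrightarrow> f p \<in> {1..n} \<and>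
      pat (f p) \<in> {({1, fst p}, {1..4} - snd p), ({1..4} - {1, fst p}, snd p)}"
    by (metis (no_types, lifting) bchoice)
  have "inj_on f K"
  proof (rule inj_onI, clarify)
    fix k J k' J'
    assume K: "(k, J) \<in> K" "(k', J') \<in> K" and eq: "f (k, J) = f (k', J')"
    have sub: "J \<subseteq> {1..4}" "J' \<subseteq> {1..4}" "k \<in> {2..4}" "k' \<in> {2..4}"
      using K by (auto simp: K_def \<J>_def)
    \<comment> \<open>Only one side of each inequality contains 1, so equal patterns must come from
      the same alternative.\<close>
    have "{1..4} - {1, k} \<noteq> {1, k'}" "{1, k} \<noteq> {1..4} - {1, k'}" by blast+
    then consider "{1, k} = {1, k'}" "{1..4} - J = {1..4} - J'"
      | "{1..4} - {1, k} = {1..4} - {1, k'}" "J = J'"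
      using f[OF K(1)] f[OF K(2)] eq by auto
    then have "{1, k} = {1, k'} \<and> J = J'"
    proof cases
      case 1
      then show ?thesis using sub by blast
    next
      case 2
      moreover have "{1, k} \<subseteq> {1..4}" "{1, k'} \<subseteq> {1..4}" using sub by auto
      ultimately show ?thesis by blast
    qed
    then show "k = k' \<and> J = J'" using sub by (auto simp: doubleton_eq_iff)
  qed
  moreover have "f ` K \<subseteq> {1..n}" using f by (auto simp: image_subset_iff)
  ultimately have "card K \<le> n" using card_inj_on_le[of f K "{1..n}"] by simp
  moreover have "card K = 18"
    by (simp add: K_def \<J>_def card_cartesian_product n_subsets numeral_eq_Suc)
  ultimately show False using assms(2) by simp
qed

end
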